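(* Let $a>0$, $\mathbb{P}=\frac12\begin{pmatrix}1&1/a\\ a&1\end{pmatrix}$, $X=\begin{pmatrix}1&0\\ 0&-1\end{pmatrix}$, and for $\sigma_1,\sigma_2\in\mathbb{C}\setminus\{0,-1\}$ let $$J_2=\begin{pmatrix}(1+\sigma_1)\mathrm{I}-\mathbb{P}&0\\ 0&(1+\sigma_2)\mathrm{I}-\mathbb{P}\end{pmatrix}^{-1}\begin{pmatrix}0&\sigma_1X\\ \sigma_2X&0\end{pmatrix}.$$ Then, as $\sigma_1,\sigma_2\to0$, the matrix $J_2$ converges to $$J_2^0:=\begin{pmatrix}0&\mathbb{P}X\\ \mathbb{P}X&0\end{pmatrix},$$ and $(J_2^0)^2=0$. Consequently, for all $\alpha,\beta$ and every initial guess $(U_1^0,U_2^0)$, the iteration $$\begin{pmatrix}U_1\\ U_2\end{pmatrix}^{n+1}=\begin{pmatrix}0&\mathbb{P}X\\ \mathbb{P}X&0\end{pmatrix}\begin{pmatrix}U_1\\ U_2\end{pmatrix}^{n}+\begin{pmatrix}-\mathbb{P}X(\alpha,\beta)^T\\ \mathbb{P}(\alpha,\beta)^T\end{pmatrix}$$ converges in at most $2$ iterations to the solution of $$U_1-\mathbb{P}XU_2=-\mathbb{P}X(\alpha,\beta)^T,\qquad U_2-\mathbb{P}XU_1=\mathbb{P}(\alpha,\beta)^T .$$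
   Context: $\mathrm{I}$ is the $2\times2$ identity matrix and $U_1,U_2\in\mathbb{C}^2$. "Converges in at most $2$ iterations" means that the iterate with index $n$ equals the solution for all $n\ge 2$. The iteration is the limit, for vanishing relaxation parameters, of the block Jacobi iteration for the multitrace formulation of $-u''+a^2u=0$ on $\mathbb{R}\setminus\{0\}$ with Dirichlet jump $\alpha$ and Neumann jump $\beta$ at $0$. *)

theory Defs
  imports "HOL-Analysis.Analysis"
begin

text \<open>Block matrices and block vectors are indexed by the sum type \<open>2 + 2\<close>:
  \<open>Inl\<close> is the first block and \<open>Inr\<close> the second.\<close>

definition block_mat ::
  "'c^'n^'m \<Rightarrow> 'c^'q^'m \<Rightarrow> 'c^'n^'p \<Rightarrow> 'c^'q^'p \<Rightarrow> 'c^('n + 'q)^('m + 'p)" where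
  "block_mat A B C D =
     (\<chi> i j. case i of
        Inl k \<Rightarrow> (case j of Inl l \<Rightarrow> A $ k $ l | Inr l \<Rightarrow> B $ k $ l)
      | Inr k \<Rightarrow> (case j of Inl l \<Rightarrow> C $ k $ l | Inr l \<Rightarrow> D $ k $ l))"

definition block_vec :: "'c^'m \<Rightarrow> 'c^'p \<Rightarrow> 'c^('m + 'p)" where
  "block_vec u v = (\<chi> i. case i of Inl k \<Rightarrow> u $ k | Inr k \<Rightarrow> v $ k)"

text \<open>The library only scales matrices by real numbers (\<open>*\<^sub>R\<close>).\<close>

definition mscale :: "'c::times \<Rightarrow> 'c^'n^'m \<Rightarrow> 'c^'n^'m" where
  "mscale c A = (\<chi> i j. c * A $ i $ j)"

definition calderon :: "real \<Rightarrow> complex^2^2" where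
  "calderon a = mscale (1/2)
     (vector [vector [1, 1 / complex_of_real a],
              vector [complex_of_real a, 1]])"

definition Xmat :: "complex^2^2" where
  "Xmat = vector [vector [1, 0], vector [0, -1]]"

text \<open>Here \<open>mat (1 + \<sigma>)\<close> is \<open>(1 + \<sigma>) I\<close>.\<close>

definition J2_diag :: "real \<Rightarrow> complex \<Rightarrow> complex \<Rightarrow> complex^(2 + 2)^(2 + 2)" where
  "J2_diag a \<sigma>1 \<sigma>2 =
     block_mat (mat (1 + \<sigma>1) - calderon a) 0
               0 (mat (1 + \<sigma>2) - calderon a)"

definition J2 :: "real \<Rightarrow> complex \<Rightarrow> complex \<Rightarrow> complex^(2 + 2)^(2 + 2)" where
  "J2 a \<sigma>1 \<sigma>2 =
     matrix_inv (J2_diag a \<sigma>1 \<sigma>2) **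
     block_mat 0 (mscale \<sigma>1 Xmat)
               (mscale \<sigma>2 Xmat) 0"

definition J20 :: "real \<Rightarrow> complex^(2 + 2)^(2 + 2)" where
  "J20 a = block_mat 0 (calderon a ** Xmat)
                     (calderon a ** Xmat) 0"

primrec jacobi_iter ::
  "real \<Rightarrow> complex \<Rightarrow> complex \<Rightarrow> complex^(2 + 2) \<Rightarrow> nat \<Rightarrow> complex^(2 + 2)" where
  "jacobi_iter a \<alpha> \<beta> U 0 = U"
| "jacobi_iter a \<alpha> \<beta> U (Suc n) =
     J20 a *v jacobi_iter a \<alpha> \<beta> U n +
     block_vec (- ((calderon a ** Xmat) *v vector [\<alpha>, \<beta>]))
               (calderon a *v vector [\<alpha>, \<beta>])"

definition is_solution ::
  "real \<Rightarrow> complex \<Rightarrow> complex \<Rightarrow> (complex^2) \<times> (complex^2) \<Rightarrow> bool" where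
  "is_solution a \<alpha> \<beta> = (\<lambda>(U1, U2).
     U1 - (calderon a ** Xmat) *v U2 = - ((calderon a ** Xmat) *v vector [\<alpha>, \<beta>]) \<and>
     U2 - (calderon a ** Xmat) *v U1 = calderon a *v vector [\<alpha>, \<beta>])"

end

theory Submission
  imports Defs
begin

text \<open>
  The Calderon projector \<open>P\<close> satisfies \<open>P\<^sup>2 = P\<close> and \<open>X P X = I - P\<close>. The first identity turns
  \<open>(1 + \<sigma>) I - P\<close> into \<open>\<sigma> P + (1 + \<sigma>) (I - P)\<close>, with inverse \<open>P / \<sigma> + (I - P) / (1 + \<sigma>)\<close>, so that the
  nonzero blocks of \<open>J\<^sub>2\<close> are \<open>P X + (\<sigma> / (1 + \<sigma>)) (I - P) X\<close>, which tend to \<open>P X\<close>. The second identity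
  gives \<open>(P X)\<^sup>2 = P (I - P) = 0\<close>, hence the iteration matrix is nilpotent and the iterates are
  constant from index 2 on.
\<close>

text \<open>Sums over the block index type split into one sum per block; the rules for multiplying
  block matrices and block vectors rest on this.\<close>

lemma sum_UNIV_sum:
  fixes f :: "'a::finite + 'b::finite \<Rightarrow> 'c::comm_monoid_add"
  shows "sum f UNIV = (\<Sum>i\<in>UNIV. f (Inl i)) + (\<Sum>j\<in>UNIV. f (Inr j))"
  by (simp flip: UNIV_Plus_UNIV add: sum.Plus comp_def)

lemma block_mat_mult:
  fixes A :: "'c::semiring_1^'n^'m" and B :: "'c^'q^'m"
    and C :: "'c^'n^'p" and D :: "'c^'q^'p"
    and E :: "'c^'r^'n" and F :: "'c^'s^'n"
    and G :: "'c^'r^'q" and H :: "'c^'s^'q"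
  shows "block_mat A B C D ** block_mat E F G H =
    block_mat (A ** E + B ** G) (A ** F + B ** H) (C ** E + D ** G) (C ** F + D ** H)"
  by (auto simp: vec_eq_iff block_mat_def matrix_matrix_mult_def sum_UNIV_sum split: sum.splits)

lemma block_mat_vec_mult:
  fixes A :: "'c::semiring_1^'n^'m" and B :: "'c^'q^'m"
    and C :: "'c^'n^'p" and D :: "'c^'q^'p"
  shows "block_mat A B C D *v block_vec u v = block_vec (A *v u + B *v v) (C *v u + D *v v)"
  by (auto simp: vec_eq_iff block_mat_def block_vec_def matrix_vector_mult_def sum_UNIV_sum
      split: sum.splits)

lemma block_vec_add: "block_vec u v + block_vec u' v' = block_vec (u + u') (v + v')"
  by (auto simp: vec_eq_iff block_vec_def split: sum.splits)

lemma block_vec_eq_iff: "block_vec u v = block_vec u' v' \<longleftrightarrow> u = u' \<and> v = v'"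
proof
  assume eq: "block_vec u v = block_vec u' v'"
  have "block_vec u v $ Inl i = block_vec u' v' $ Inl i"
    and "block_vec u v $ Inr j = block_vec u' v' $ Inr j" for i j
    using eq by simp_all
  then show "u = u' \<and> v = v'"
    by (simp add: vec_eq_iff block_vec_def)
qed simp

text \<open>\<open>is_solution\<close> speaks of pairs, the iteration of vectors over the sum type;
  this turns a vector back into a pair.\<close>

lemma block_vec_cases:
  obtains u v where "w = block_vec u v"
proof
  show "w = block_vec (\<chi> i. w $ Inl i) (\<chi> j. w $ Inr j)"
    by (auto simp: vec_eq_iff block_vec_def split: sum.splits)
qed

lemma block_mat_id: "block_mat (mat 1) 0 0 (mat 1) = mat 1"
  by (auto simp: vec_eq_iff block_mat_def mat_def split: sum.splits)

lemma block_mat_zero: "block_mat 0 0 0 0 = 0"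
  by (auto simp: vec_eq_iff block_mat_def split: sum.splits)

lemma tendsto_block_mat:
  assumes "(A \<longlongrightarrow> A') F" "(B \<longlongrightarrow> B') F" "(C \<longlongrightarrow> C') F" "(D \<longlongrightarrow> D') F"
  shows "((\<lambda>x. block_mat (A x) (B x) (C x) (D x)) \<longlongrightarrow> block_mat A' B' C' D') F"
proof (intro vec_tendstoI)
  fix i j
  show "((\<lambda>x. block_mat (A x) (B x) (C x) (D x) $ i $ j) \<longlongrightarrow> block_mat A' B' C' D' $ i $ j) F"
    unfolding block_mat_def
    by (cases i; cases j) (auto intro!: tendsto_vec_nth assms)
qed

lemma tendsto_mscale:
  fixes c :: "'a \<Rightarrow> 'b::real_normed_algebra"
  assumes "(c \<longlongrightarrow> c') F"
  shows "((\<lambda>x. mscale (c x) A) \<longlongrightarrow> mscale c' A) F"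
  unfolding mscale_def by (intro vec_tendstoI) (auto intro!: tendsto_intros assms)

lemma mscale_matrix_mult: "mscale c A ** B = mscale c (A ** B)"
  for c :: "'c::semiring_1"
  by (simp add: vec_eq_iff mscale_def matrix_matrix_mult_def sum_distrib_left mult.assoc)

lemma matrix_mult_mscale: "A ** mscale c B = mscale c (A ** B)"
  for c :: "'c::comm_semiring_1"
  by (simp add: vec_eq_iff mscale_def matrix_matrix_mult_def sum_distrib_left mult.left_commute)

lemma mscale_mscale: "mscale c (mscale d A) = mscale (c * d) A"
  for c :: "'c::semigroup_mult"
  by (simp add: vec_eq_iff mscale_def mult.assoc)

lemma mscale_one: "mscale 1 A = A" for A :: "'c::monoid_mult^'n^'m"
  by (simp add: vec_eq_iff mscale_def)

lemma mscale_zero_left: "mscale 0 A = 0" for A :: "'c::mult_zero^'n^'m"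
  by (simp add: vec_eq_iff mscale_def)

lemma mscale_zero_right: "mscale c 0 = 0" for c :: "'c::mult_zero"
  by (simp add: vec_eq_iff mscale_def)

lemma mscale_add: "mscale c (A + B) = mscale c A + mscale c B" for c :: "'c::semiring"
  by (simp add: vec_eq_iff mscale_def distrib_left)

lemmas mscale_simps = mscale_add mscale_matrix_mult matrix_mult_mscale mscale_mscale mscale_one
  mscale_zero_left mscale_zero_right

lemma matrix_mult_add_right: "(A + B) ** C = A ** C + B ** C"
  by (simp add: vec_eq_iff matrix_matrix_mult_def distrib_right sum.distrib)

lemma matrix_mult_diff_right: "(A - B) ** C = A ** C - B ** C"
  for A :: "'c::ring_1^'n^'m"
  by (simp add: vec_eq_iff matrix_matrix_mult_def left_diff_distrib sum_subtractf)

lemma matrix_mult_diff_left: "A ** (B - C) = A ** B - A ** C"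
  for A :: "'c::ring_1^'n^'m"
  by (simp add: vec_eq_iff matrix_matrix_mult_def right_diff_distrib sum_subtractf)

text \<open>\<open>matrix_inv\<close> is a Hilbert choice: \<open>B\<close> shows that some
  two-sided inverse exists, and uniqueness of inverses identifies the chosen one with
  \<open>B\<close>.\<close>

lemma matrix_inv_eqI:
  fixes A :: "'c::semiring_1^'n^'m"
  assumes "A ** B = mat 1" "B ** A = mat 1"
  shows "matrix_inv A = B"
proof -
  have "A ** matrix_inv A = mat 1 \<and> matrix_inv A ** A = mat 1"
    unfolding matrix_inv_def by (rule someI[of _ B]) (simp add: assms)
  then show ?thesis
    by (metis assms(1) matrix_mul_assoc matrix_mul_lid matrix_mul_rid)
qed

text \<open>For idempotent \<open>P\<close> this is the spectral form of the resolvent at 1 +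
  \<sigma>, since (1 + \<sigma>) I - P acts as \<sigma> on the range of \<open>P\<close> and as 1 +
  \<sigma> on its kernel.\<close>

definition projector_resolvent :: "complex^'n^'n \<Rightarrow> complex \<Rightarrow> complex^'n^'n" where
  "projector_resolvent P \<sigma> = mscale (1 / \<sigma>) P + mscale (1 / (1 + \<sigma>)) (mat 1 - P)"

text \<open>With Q = I - P, both factors are combinations of the complementary projectors
  \<open>P\<close> and \<open>Q\<close>, whose mixed products vanish. The coefficients therefore
  multiply separately, each pair to 1, and P + Q = I remains.\<close>

lemma projector_resolvent_inverse:
  fixes P :: "complex^'n^'n"
  assumes P: "P ** P = P" and \<sigma>: "\<sigma> \<notin> {0, -1}"
  shows "(mat (1 + \<sigma>) - P) ** projector_resolvent P \<sigma> = mat 1"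
    and "projector_resolvent P \<sigma> ** (mat (1 + \<sigma>) - P) = mat 1"
proof -
  have nz: "\<sigma> \<noteq> 0" "1 + \<sigma> \<noteq> 0"
    using \<sigma> by (auto simp: add_eq_0_iff)
  define Q where "Q = mat 1 - P"
  have prods: "P ** Q = 0" "Q ** P = 0" "Q ** Q = Q" "P ** P = P"
    by (simp_all add: Q_def P matrix_mult_diff_left matrix_mult_diff_right)
  have split: "mat (1 + \<sigma>) - P = mscale \<sigma> P + mscale (1 + \<sigma>) Q"
    by (simp add: vec_eq_iff mscale_def Q_def mat_def algebra_simps)
  have one: "P + Q = mat 1"
    by (simp add: Q_def)
  show "(mat (1 + \<sigma>) - P) ** projector_resolvent P \<sigma> = mat 1"
    "projector_resolvent P \<sigma> ** (mat (1 + \<sigma>) - P) = mat 1"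
    unfolding split projector_resolvent_def Q_def[symmetric]
    using nz by (simp_all add: matrix_add_ldistrib matrix_mult_add_right mscale_simps prods one)
qed

text \<open>The factor \<sigma> cancels the pole 1 / \<sigma> on the range of \<open>P\<close>; this
  is why \<open>J2\<close> has a finite limit although its diagonal blocks become singular.\<close>

lemma projector_resolvent_scaled:
  fixes P :: "complex^'n^'n"
  assumes "\<sigma> \<noteq> 0"
  shows "projector_resolvent P \<sigma> ** mscale \<sigma> Y =
    P ** Y + mscale (\<sigma> / (1 + \<sigma>)) ((mat 1 - P) ** Y)"
  using assms
  by (simp add: projector_resolvent_def matrix_mult_add_right mscale_simps)

lemma block_diag_inverse:
  fixes A :: "'c::semiring_1^'n^'m" and B :: "'c^'q^'p"
  assumes "A ** A' = mat 1" "A' ** A = mat 1" "B ** B' = mat 1" "B' ** B = mat 1"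
  shows "block_mat A 0 0 B ** block_mat A' 0 0 B' = mat 1"
    and "block_mat A' 0 0 B' ** block_mat A 0 0 B = mat 1"
  by (simp_all add: block_mat_mult block_mat_id assms)

text \<open>The matrix is the rank-one product of the column (1, a) and the row (1, 1/a), divided by
  2, and that row times that column is 2.\<close>

lemma calderon_idem:
  assumes "a \<noteq> 0"
  shows "calderon a ** calderon a = calderon a"
  using assms
  by (simp add: vec_eq_iff forall_2 sum_2 matrix_matrix_mult_def calderon_def mscale_def)

text \<open>The product \<open>calderon a ** Xmat\<close> has trace 0 and determinant 0, so its
  square vanishes by Cayley-Hamilton; the entrywise computation confirms this.\<close>

lemma calderon_Xmat_nilpotent:
  assumes "a \<noteq> 0"
  shows "(calderon a ** Xmat) ** (calderon a ** Xmat) = 0"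
  using assms
  by (simp add: vec_eq_iff forall_2 sum_2 matrix_matrix_mult_def calderon_def Xmat_def mscale_def)

lemma J2_diag_inverse:
  assumes "a \<noteq> 0" "\<sigma>1 \<notin> {0, -1}" "\<sigma>2 \<notin> {0, -1}"
  defines "R \<equiv> block_mat (projector_resolvent (calderon a) \<sigma>1) 0
                          0 (projector_resolvent (calderon a) \<sigma>2)"
  shows "J2_diag a \<sigma>1 \<sigma>2 ** R = mat 1" and "R ** J2_diag a \<sigma>1 \<sigma>2 = mat 1"
  unfolding J2_diag_def R_def
  using assms by (auto intro!: block_diag_inverse projector_resolvent_inverse calderon_idem)

lemma J2_eq:
  assumes "a \<noteq> 0" "\<sigma>1 \<notin> {0, -1}" "\<sigma>2 \<notin> {0, -1}"
  defines "N \<equiv> \<lambda>\<sigma>. calderon a ** Xmat + mscale (\<sigma> / (1 + \<sigma>)) ((mat 1 - calderon a) ** Xmat)"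
  shows "J2 a \<sigma>1 \<sigma>2 = block_mat 0 (N \<sigma>1) (N \<sigma>2) 0"
proof -
  have "matrix_inv (J2_diag a \<sigma>1 \<sigma>2) =
    block_mat (projector_resolvent (calderon a) \<sigma>1) 0 0 (projector_resolvent (calderon a) \<sigma>2)"
    using J2_diag_inverse[OF assms(1-3)] by (rule matrix_inv_eqI)
  then show ?thesis
    using assms by (simp add: J2_def N_def block_mat_mult projector_resolvent_scaled)
qed

lemma J2_tendsto:
  assumes "a \<noteq> 0"
  shows "((\<lambda>(\<sigma>1, \<sigma>2). J2 a \<sigma>1 \<sigma>2) \<longlongrightarrow> J20 a) (at (0, 0) within (- {0, -1}) \<times> (- {0, -1}))"
    (is "(_ \<longlongrightarrow> _) ?F")
proof -
  define N where "N \<sigma> = calderon a ** Xmat + mscale (\<sigma> / (1 + \<sigma>)) ((mat 1 - calderon a) ** Xmat)" for \<sigma>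
  have N: "((\<lambda>x. N (g x)) \<longlongrightarrow> calderon a ** Xmat) ?F" if "(g \<longlongrightarrow> 0) ?F" for g
  proof -
    have "((\<lambda>x. g x / (1 + g x)) \<longlongrightarrow> 0 / (1 + 0)) ?F"
      using that by (intro tendsto_intros) simp_all
    then have "((\<lambda>x. N (g x)) \<longlongrightarrow>
        calderon a ** Xmat + mscale (0 / (1 + 0)) ((mat 1 - calderon a) ** Xmat)) ?F"
      unfolding N_def by (intro tendsto_add tendsto_const tendsto_mscale)
    then show ?thesis
      by (simp add: mscale_simps)
  qed
  have "(fst \<longlongrightarrow> (0::complex)) ?F" "(snd \<longlongrightarrow> (0::complex)) ?F"
    by (auto intro!: tendsto_eq_intros)
  then have "((\<lambda>x. block_mat 0 (N (fst x)) (N (snd x)) 0) \<longlongrightarrow> J20 a) ?F"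
    unfolding J20_def by (intro tendsto_block_mat tendsto_const N)
  \<comment> \<open>The closed form is available only where both parameters avoid 0 and -1, which is
    exactly the set along which the limit is taken.\<close>
  moreover have "\<forall>\<^sub>F x in ?F. block_mat 0 (N (fst x)) (N (snd x)) 0 = (\<lambda>(\<sigma>1, \<sigma>2). J2 a \<sigma>1 \<sigma>2) x"
    unfolding eventually_at_filter
    by (intro always_eventually) (auto simp: J2_eq[OF assms] N_def)
  ultimately show ?thesis
    by (rule Lim_transform_eventually)
qed

lemma J20_nilpotent:
  assumes "a \<noteq> 0"
  shows "J20 a ** J20 a = 0"
  by (simp add: J20_def block_mat_mult calderon_Xmat_nilpotent[OF assms] block_mat_zero)

lemma is_solution_iff_fixed_point:
  "is_solution a \<alpha> \<beta> (V1, V2) \<longleftrightarrow>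
    block_vec V1 V2 = J20 a *v block_vec V1 V2 +
      block_vec (- ((calderon a ** Xmat) *v vector [\<alpha>, \<beta>])) (calderon a *v vector [\<alpha>, \<beta>])"
  by (auto simp: is_solution_def J20_def block_mat_vec_mult block_vec_add block_vec_eq_iff
      algebra_simps)

text \<open>The starting vector enters two steps of the affine map only through N (N u) = 0, so it
  is forgotten.\<close>

lemma nilpotent_affine_twice:
  fixes N :: "'c::comm_semiring_1^'n^'n"
  assumes "N ** N = 0"
  shows "N *v (N *v u + b) + b = N *v b + b"
  by (simp add: matrix_vector_right_distrib matrix_vector_mul_assoc assms)

text \<open>A fixed point equals its own image after two steps, which is N b + b; conversely, two
  steps from u = b show that N b + b is fixed.\<close>

lemma nilpotent_fixed_point_iff:
  fixes N :: "'c::comm_semiring_1^'n^'n"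
  assumes "N ** N = 0"
  shows "v = N *v v + b \<longleftrightarrow> v = N *v b + b"
  by (metis nilpotent_affine_twice[OF assms])

theorem mainTheorem2:
  fixes a :: real
  assumes "a > 0"
  shows "(\<forall>\<sigma>1 \<sigma>2. \<sigma>1 \<notin> {0, -1} \<longrightarrow> \<sigma>2 \<notin> {0, -1} \<longrightarrow> invertible (J2_diag a \<sigma>1 \<sigma>2)) \<and>
    ((\<lambda>(\<sigma>1, \<sigma>2). J2 a \<sigma>1 \<sigma>2) \<longlongrightarrow> J20 a)
      (at (0, 0) within (- {0, -1}) \<times> (- {0, -1})) \<and>
    J20 a ** J20 a = 0 \<and>
    (\<forall>\<alpha> \<beta>.
      (\<exists>!V. is_solution a \<alpha> \<beta> V) \<and>
      (\<forall>V1 V2. is_solution a \<alpha> \<beta> (V1, V2) \<longrightarrow>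
        (\<forall>U1 U2. \<forall>n\<ge>2. jacobi_iter a \<alpha> \<beta> (block_vec U1 U2) n = block_vec V1 V2)))"
proof (intro conjI allI impI)
  have a: "a \<noteq> 0"
    using assms by simp
  show "invertible (J2_diag a \<sigma>1 \<sigma>2)" if "\<sigma>1 \<notin> {0, -1}" "\<sigma>2 \<notin> {0, -1}" for \<sigma>1 \<sigma>2
    unfolding invertible_def using J2_diag_inverse[OF a that] by blast
  show "((\<lambda>(\<sigma>1, \<sigma>2). J2 a \<sigma>1 \<sigma>2) \<longlongrightarrow> J20 a)
      (at (0, 0) within (- {0, -1}) \<times> (- {0, -1}))"
    by (rule J2_tendsto[OF a])
  show "J20 a ** J20 a = 0"
    by (rule J20_nilpotent[OF a])
  fix \<alpha> \<beta>
  define b where "b = block_vec (- ((calderon a ** Xmat) *v vector [\<alpha>, \<beta>]))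
    (calderon a *v vector [\<alpha>, \<beta>])"
  \<comment> \<open>Solutions are the fixed points of the Jacobi step, so this one explicit vector
    yields existence, uniqueness and the value of the late iterates.\<close>
  have sol: "is_solution a \<alpha> \<beta> (V1, V2) \<longleftrightarrow> block_vec V1 V2 = J20 a *v b + b" for V1 V2
    unfolding is_solution_iff_fixed_point b_def[symmetric]
    by (rule nilpotent_fixed_point_iff[OF J20_nilpotent[OF a]])
  obtain W1 W2 where W: "J20 a *v b + b = block_vec W1 W2"
    by (rule block_vec_cases)
  show "\<exists>!V. is_solution a \<alpha> \<beta> V"
  proof (rule ex1I)
    show "is_solution a \<alpha> \<beta> (W1, W2)"
      by (simp add: sol W)
    show "V = (W1, W2)" if "is_solution a \<alpha> \<beta> V" for V
      using that by (cases V) (simp add: sol W block_vec_eq_iff)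
  qed
  fix V1 V2 U1 U2 and n :: nat
  assume V: "is_solution a \<alpha> \<beta> (V1, V2)" and "2 \<le> n"
  \<comment> \<open>Index n \<ge> 2 exposes the last two steps; the iterate with index
    \<open>m\<close> plays the role of the forgotten starting vector.\<close>
  then obtain m where "n = Suc (Suc m)"
    by (metis Suc_le_D numeral_2_eq_2 Suc_le_mono)
  then show "jacobi_iter a \<alpha> \<beta> (block_vec U1 U2) n = block_vec V1 V2"
    using V by (simp add: b_def[symmetric] sol nilpotent_affine_twice[OF J20_nilpotent[OF a]])
qed

end
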